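(* Let $R$ be a ring with identity and let $\varphi,\sigma\in\mathrm{End}_R(M)$ be $R$-endomorphisms of a finitely generated semisimple left $R$-module ${}_RM$. Then the following are equivalent: 1. $\mathrm{Cen}_0(\varphi)\subseteq\mathrm{Cen}_0(\sigma)$; 2. $\ker(\varphi)\subseteq\ker(\sigma)$ and $\mathrm{im}(\sigma)\subseteq\mathrm{im}(\varphi)$.
   Context: For $\varphi\in\mathrm{End}_R(M)$, the zero-level centralizer is $\mathrm{Cen}_0(\varphi)=\{\psi\in\mathrm{End}_R(M)\mid\psi\circ\varphi=\varphi\circ\psi=0\}$. *)

theory Defs
  imports "HOL-Algebra.Algebra" "HOL.Hull"
begin

text \<open>
  The library locale \<open>module\<close> demands a commutative ring of scalars, so left modules over an
  arbitrary ring with identity (the zero ring included) are introduced here on the same record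
  type. As in the library, the multiplicative fields \<open>mult\<close> and \<open>one\<close> of the module record are
  unconstrained and play no role. The library locale \<open>submodule\<close> does not use commutativity and
  is reused as it is.
\<close>

locale left_module = R?: ring R + M?: abelian_group M
  for R :: "('a, 'm) ring_scheme" and M :: "('a, 'b, 'n) module_scheme" +
  assumes smult_closed:
      "\<lbrakk>a \<in> carrier R; x \<in> carrier M\<rbrakk> \<Longrightarrow> a \<odot>\<^bsub>M\<^esub> x \<in> carrier M"
    and smult_l_distr:
      "\<lbrakk>a \<in> carrier R; b \<in> carrier R; x \<in> carrier M\<rbrakk> \<Longrightarrow>
        (a \<oplus>\<^bsub>R\<^esub> b) \<odot>\<^bsub>M\<^esub> x = a \<odot>\<^bsub>M\<^esub> x \<oplus>\<^bsub>M\<^esub> b \<odot>\<^bsub>M\<^esub> x"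
    and smult_r_distr:
      "\<lbrakk>a \<in> carrier R; x \<in> carrier M; y \<in> carrier M\<rbrakk> \<Longrightarrow>
        a \<odot>\<^bsub>M\<^esub> (x \<oplus>\<^bsub>M\<^esub> y) = a \<odot>\<^bsub>M\<^esub> x \<oplus>\<^bsub>M\<^esub> a \<odot>\<^bsub>M\<^esub> y"
    and smult_assoc1:
      "\<lbrakk>a \<in> carrier R; b \<in> carrier R; x \<in> carrier M\<rbrakk> \<Longrightarrow>
        (a \<otimes>\<^bsub>R\<^esub> b) \<odot>\<^bsub>M\<^esub> x = a \<odot>\<^bsub>M\<^esub> (b \<odot>\<^bsub>M\<^esub> x)"
    and smult_one:
      "x \<in> carrier M \<Longrightarrow> \<one>\<^bsub>R\<^esub> \<odot>\<^bsub>M\<^esub> x = x"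

lemma left_module_if_module: "module R M \<Longrightarrow> left_module R M"
  unfolding module_def module_axioms_def left_module_def left_module_axioms_def
  by (auto simp: cring.axioms(1))

text \<open>Only meant for \<open>A \<subseteq> carrier M\<close>; otherwise the hull is an intersection over no submodules.\<close>

definition submodule_span ::
    "('a, 'm) ring_scheme \<Rightarrow> ('a, 'b, 'n) module_scheme \<Rightarrow> 'b set \<Rightarrow> 'b set"
  where "submodule_span R M A = (\<lambda>N. submodule N R M) hull A"

definition finitely_generated_module ::
    "('a, 'm) ring_scheme \<Rightarrow> ('a, 'b, 'n) module_scheme \<Rightarrow> bool"
  where "finitely_generated_module R M \<longleftrightarrow>
    (\<exists>A. finite A \<and> A \<subseteq> carrier M \<and> submodule_span R M A = carrier M)"

definition simple_submodule ::
    "'b set \<Rightarrow> ('a, 'm) ring_scheme \<Rightarrow> ('a, 'b, 'n) module_scheme \<Rightarrow> bool"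
  where "simple_submodule N R M \<longleftrightarrow>
    submodule N R M \<and> N \<noteq> {\<zero>\<^bsub>M\<^esub>} \<and>
    (\<forall>K. submodule K R M \<and> K \<subseteq> N \<longrightarrow> K = {\<zero>\<^bsub>M\<^esub>} \<or> K = N)"

text \<open>
  Semisimple: \<open>M\<close> is the internal direct sum of simple submodules. The summands form a set
  rather than an indexed family, since nonzero summands of a direct sum are pairwise distinct;
  the empty set of summands gives the zero module, which is semisimple.
\<close>

definition semisimple_module ::
    "('a, 'm) ring_scheme \<Rightarrow> ('a, 'b, 'n) module_scheme \<Rightarrow> bool"
  where "semisimple_module R M \<longleftrightarrow>
    (\<exists>\<S>. (\<forall>N\<in>\<S>. simple_submodule N R M) \<and>
         submodule_span R M (\<Union>\<S>) = carrier M \<and>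
         (\<forall>N\<in>\<S>. N \<inter> submodule_span R M (\<Union>(\<S> - {N})) = {\<zero>\<^bsub>M\<^esub>}))"

text \<open>
  As with the library's \<open>hom\<close>, the values of an endomorphism outside the carrier are irrelevant.
  Equations between endomorphisms are therefore stated for their restrictions to the carrier.
\<close>

definition module_End ::
    "('a, 'm) ring_scheme \<Rightarrow> ('a, 'b, 'n) module_scheme \<Rightarrow> ('b \<Rightarrow> 'b) set"
  where "module_End R M =
    {f \<in> hom (add_monoid M) (add_monoid M).
      \<forall>r\<in>carrier R. \<forall>x\<in>carrier M. f (r \<odot>\<^bsub>M\<^esub> x) = r \<odot>\<^bsub>M\<^esub> f x}"

definition zero_centralizer ::
    "('a, 'm) ring_scheme \<Rightarrow> ('a, 'b, 'n) module_scheme \<Rightarrow> ('b \<Rightarrow> 'b) \<Rightarrow> ('b \<Rightarrow> 'b) set"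
  where "zero_centralizer R M \<phi> =
    {\<psi> \<in> module_End R M.
      compose (carrier M) \<psi> \<phi> = (\<lambda>x\<in>carrier M. \<zero>\<^bsub>M\<^esub>) \<and>
      compose (carrier M) \<phi> \<psi> = (\<lambda>x\<in>carrier M. \<zero>\<^bsub>M\<^esub>)}"

end

theory Submission
  imports Defs
begin

text \<open>
  The implication from kernels and images to centralizers is immediate: if \<open>\<psi>\<close> annihilates \<open>\<phi>\<close> on
  both sides, then \<open>im \<psi> \<subseteq> ker \<phi> \<subseteq> ker \<sigma>\<close> and \<open>im \<sigma> \<subseteq> im \<phi> \<subseteq> ker \<psi>\<close>. The converse says that there are
  enough maps in \<open>Cen\<^sub>0(\<phi>)\<close>, the endomorphisms that vanish on \<open>im \<phi>\<close> and take values in \<open>ker \<phi>\<close>: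
  their images together generate \<open>ker \<phi>\<close>, and their common kernel is \<open>im \<phi>\<close>. One could derive this
  from \<open>M / im \<phi> \<cong> ker \<phi>\<close>, a cancellation theorem for modules of finite length; the argument below
  avoids composition series and simple constituents.

  Semisimplicity is used only through the existence of complements, which yields projections and,
  for each endomorphism \<open>f\<close>, a generalized inverse \<open>g\<close> with \<open>f g f = f\<close> and \<open>g f g = g\<close>. Finite
  generation then makes ascending chains of submodules stationary.

  Kernels (\<open>kernel_subset_if_annihilates\<close>). Filter \<open>ker f\<close> by the submodules
  \<open>ker f \<inter> im f\<^sup>i\<close>. They vanish for large \<open>i\<close>, because the chain of the \<open>ker f\<^sup>i\<close> is stationary. A
  complement of \<open>ker f \<inter> im f\<^sup>i\<^sup>+\<^sup>1\<close> in \<open>ker f \<inter> im f\<^sup>i\<close> is the image under \<open>f\<^sup>i\<close> of a submodule \<open>T\<close> that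
  meets \<open>im f\<close> trivially, so it is the image of \<open>f\<^sup>i p\<close> with \<open>p\<close> a projection onto \<open>T\<close> that kills
  \<open>im f\<close>; and \<open>f\<^sup>i p\<close> lies in \<open>Cen\<^sub>0(f)\<close>. Hence a map that annihilates the images of all members of
  \<open>Cen\<^sub>0(f)\<close> annihilates the layers of the filtration one after the other.

  Images (\<open>image_subset_if_annihilated\<close>). A generalized inverse \<open>h\<close> of \<open>f\<close> exchanges the roles of
  kernel and image: \<open>ker h\<close> is a complement of \<open>im f\<close>. The result on kernels applies to \<open>h\<close>, and a
  generalized inverse of a map that comes from \<open>Cen\<^sub>0(h)\<close> brings it back to \<open>Cen\<^sub>0(f)\<close>.
\<close>

section \<open>Submodules and endomorphisms of left modules\<close>

context left_module
begin

lemma minus_eq_zero_iff: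
  assumes "x \<in> carrier M" "y \<in> carrier M"
  shows "x \<ominus>\<^bsub>M\<^esub> y = \<zero>\<^bsub>M\<^esub> \<longleftrightarrow> x = y"
  using assms by (metis M.add.inv_solve_right M.l_zero M.zero_closed a_minus_def)

lemma minus_zero:
  assumes "x \<in> carrier M"
  shows "x \<ominus>\<^bsub>M\<^esub> \<zero>\<^bsub>M\<^esub> = x"
  using assms by (simp add: a_minus_def)

lemma smult_zero [simp]:
  assumes "a \<in> carrier R"
  shows "a \<odot>\<^bsub>M\<^esub> \<zero>\<^bsub>M\<^esub> = \<zero>\<^bsub>M\<^esub>"
  using smult_r_distr[of a "\<zero>\<^bsub>M\<^esub>" "\<zero>\<^bsub>M\<^esub>"] smult_closed[of a "\<zero>\<^bsub>M\<^esub>"] assms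
  by simp

lemma zero_smult [simp]:
  assumes "x \<in> carrier M"
  shows "\<zero>\<^bsub>R\<^esub> \<odot>\<^bsub>M\<^esub> x = \<zero>\<^bsub>M\<^esub>"
  using smult_l_distr[of "\<zero>\<^bsub>R\<^esub>" "\<zero>\<^bsub>R\<^esub>" x] smult_closed[of "\<zero>\<^bsub>R\<^esub>" x] assms
  by simp

lemma minus_one_smult:
  assumes "x \<in> carrier M"
  shows "(\<ominus>\<^bsub>R\<^esub> \<one>\<^bsub>R\<^esub>) \<odot>\<^bsub>M\<^esub> x = \<ominus>\<^bsub>M\<^esub> x"
proof -
  have "(\<ominus>\<^bsub>R\<^esub> \<one>\<^bsub>R\<^esub>) \<odot>\<^bsub>M\<^esub> x \<oplus>\<^bsub>M\<^esub> x = \<zero>\<^bsub>M\<^esub>"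
    using smult_l_distr[of "\<ominus>\<^bsub>R\<^esub> \<one>\<^bsub>R\<^esub>" "\<one>\<^bsub>R\<^esub>" x] assms by (simp add: smult_one R.l_neg)
  then show ?thesis
    using M.minus_equality[of "(\<ominus>\<^bsub>R\<^esub> \<one>\<^bsub>R\<^esub>) \<odot>\<^bsub>M\<^esub> x" x] smult_closed[of "\<ominus>\<^bsub>R\<^esub> \<one>\<^bsub>R\<^esub>" x] assms
    by simp
qed

lemma submoduleI:
  assumes "N \<subseteq> carrier M" "\<zero>\<^bsub>M\<^esub> \<in> N"
    and "\<And>x y. \<lbrakk>x \<in> N; y \<in> N\<rbrakk> \<Longrightarrow> x \<oplus>\<^bsub>M\<^esub> y \<in> N"
    and sm: "\<And>a x. \<lbrakk>a \<in> carrier R; x \<in> N\<rbrakk> \<Longrightarrow> a \<odot>\<^bsub>M\<^esub> x \<in> N"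
  shows "submodule N R M"
proof (intro submodule.intro subgroup.intro submodule_axioms.intro)
  show "inv\<^bsub>add_monoid M\<^esub> x \<in> N" if "x \<in> N" for x
    using sm[of "\<ominus>\<^bsub>R\<^esub> \<one>\<^bsub>R\<^esub>" x] minus_one_smult[of x] that assms(1) by (auto simp: a_inv_def)
qed (use assms in auto)

lemma submodule_subset:
  assumes "submodule N R M" "x \<in> N"
  shows "x \<in> carrier M"
  using subgroup.subset[OF submodule.axioms(1)[OF assms(1)]] assms(2) by auto

lemma submodule_zero:
  assumes "submodule N R M"
  shows "\<zero>\<^bsub>M\<^esub> \<in> N"
  using subgroup.one_closed[OF submodule.axioms(1)[OF assms]] by simp

lemma submodule_add:
  assumes "submodule N R M" "x \<in> N" "y \<in> N"
  shows "x \<oplus>\<^bsub>M\<^esub> y \<in> N"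
  using subgroup.m_closed[OF submodule.axioms(1)[OF assms(1)]] assms by simp

lemma submodule_minus:
  assumes "submodule N R M" "x \<in> N" "y \<in> N"
  shows "x \<ominus>\<^bsub>M\<^esub> y \<in> N"
  using submodule_add[OF assms(1,2)] subgroup.m_inv_closed[OF submodule.axioms(1)[OF assms(1)]] assms
  by (simp add: a_minus_def a_inv_def)

lemmas submodule_smult = submodule.smult_closed

lemma submodule_carrier: "submodule (carrier M) R M"
  by (rule submoduleI) (auto intro: smult_closed)

lemma submodule_zero_set: "submodule {\<zero>\<^bsub>M\<^esub>} R M"
  by (rule submoduleI) auto

lemma submodule_Int:
  assumes "submodule A R M" "submodule B R M"
  shows "submodule (A \<inter> B) R M"
  by (rule submoduleI)
    (use assms in \<open>auto simp: submodule_zero submodule_add submodule_smult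
      dest: submodule_subset[OF assms(1)]\<close>)

lemma set_addI: "\<lbrakk>a \<in> A; b \<in> B\<rbrakk> \<Longrightarrow> a \<oplus>\<^bsub>M\<^esub> b \<in> A <+>\<^bsub>M\<^esub> B"
  unfolding set_add_def' by blast

lemma set_addE:
  assumes "x \<in> A <+>\<^bsub>M\<^esub> B"
  obtains a b where "a \<in> A" "b \<in> B" "x = a \<oplus>\<^bsub>M\<^esub> b"
  using assms unfolding set_add_def' by blast

lemma submodule_set_add:
  assumes "submodule A R M" "submodule B R M"
  shows "submodule (A <+>\<^bsub>M\<^esub> B) R M"
proof (rule submoduleI)
  note sub = submodule_subset[OF assms(1)] submodule_subset[OF assms(2)]
  show "A <+>\<^bsub>M\<^esub> B \<subseteq> carrier M"
    using sub by (auto simp: set_add_def')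
  show "\<zero>\<^bsub>M\<^esub> \<in> A <+>\<^bsub>M\<^esub> B"
    unfolding set_add_def' using submodule_zero[OF assms(1)] submodule_zero[OF assms(2)] by force
  fix x y assume "x \<in> A <+>\<^bsub>M\<^esub> B" "y \<in> A <+>\<^bsub>M\<^esub> B"
  then obtain a b a' b' where ab: "a \<in> A" "b \<in> B" "a' \<in> A" "b' \<in> B"
    and xy: "x = a \<oplus>\<^bsub>M\<^esub> b" "y = a' \<oplus>\<^bsub>M\<^esub> b'"
    by (auto simp: set_add_def')
  then have "x \<oplus>\<^bsub>M\<^esub> y = (a \<oplus>\<^bsub>M\<^esub> a') \<oplus>\<^bsub>M\<^esub> (b \<oplus>\<^bsub>M\<^esub> b')"
    using sub by (simp add: M.a_ac)
  then show "x \<oplus>\<^bsub>M\<^esub> y \<in> A <+>\<^bsub>M\<^esub> B"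
    using ab submodule_add[OF assms(1)] submodule_add[OF assms(2)] by (simp add: set_addI)
next
  note sub = submodule_subset[OF assms(1)] submodule_subset[OF assms(2)]
  fix r x assume r: "r \<in> carrier R" and "x \<in> A <+>\<^bsub>M\<^esub> B"
  then obtain a b where ab: "a \<in> A" "b \<in> B" and x: "x = a \<oplus>\<^bsub>M\<^esub> b"
    by (auto simp: set_add_def')
  then have "r \<odot>\<^bsub>M\<^esub> x = r \<odot>\<^bsub>M\<^esub> a \<oplus>\<^bsub>M\<^esub> r \<odot>\<^bsub>M\<^esub> b"
    using sub r by (simp add: smult_r_distr)
  then show "r \<odot>\<^bsub>M\<^esub> x \<in> A <+>\<^bsub>M\<^esub> B"
    using ab r submodule_smult[OF assms(1)] submodule_smult[OF assms(2)] by (simp add: set_addI)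
qed

lemma set_add_upper:
  assumes "submodule A R M" "submodule B R M"
  shows "A \<subseteq> A <+>\<^bsub>M\<^esub> B" "B \<subseteq> A <+>\<^bsub>M\<^esub> B"
proof -
  show "A \<subseteq> A <+>\<^bsub>M\<^esub> B"
  proof
    fix a assume "a \<in> A"
    then have "a = a \<oplus>\<^bsub>M\<^esub> \<zero>\<^bsub>M\<^esub>" "\<zero>\<^bsub>M\<^esub> \<in> B"
      using submodule_subset[OF assms(1)] submodule_zero[OF assms(2)] by auto
    then show "a \<in> A <+>\<^bsub>M\<^esub> B" using \<open>a \<in> A\<close> unfolding set_add_def' by blast
  qed
  show "B \<subseteq> A <+>\<^bsub>M\<^esub> B"
  proof
    fix b assume "b \<in> B"
    then have "b = \<zero>\<^bsub>M\<^esub> \<oplus>\<^bsub>M\<^esub> b" "\<zero>\<^bsub>M\<^esub> \<in> A"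
      using submodule_subset[OF assms(2)] submodule_zero[OF assms(1)] by auto
    then show "b \<in> A <+>\<^bsub>M\<^esub> B" using \<open>b \<in> B\<close> unfolding set_add_def' by blast
  qed
qed

lemma submodule_Union_chain:
  assumes "\<C> \<noteq> {}" "\<And>N. N \<in> \<C> \<Longrightarrow> submodule N R M"
    and chain: "\<And>N K. \<lbrakk>N \<in> \<C>; K \<in> \<C>\<rbrakk> \<Longrightarrow> N \<subseteq> K \<or> K \<subseteq> N"
  shows "submodule (\<Union>\<C>) R M"
proof (rule submoduleI)
  fix x y assume "x \<in> \<Union>\<C>" "y \<in> \<Union>\<C>"
  then obtain N K where NK: "N \<in> \<C>" "K \<in> \<C>" "x \<in> N" "y \<in> K"
    by blast
  then consider "x \<in> K" | "y \<in> N"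
    using chain[of N K] by auto
  then show "x \<oplus>\<^bsub>M\<^esub> y \<in> \<Union>\<C>"
    using submodule_add[OF assms(2)] NK by cases blast+
next
  show "\<Union>\<C> \<subseteq> carrier M" "\<zero>\<^bsub>M\<^esub> \<in> \<Union>\<C>"
    using assms(1) submodule_subset[OF assms(2)] submodule_zero[OF assms(2)] by blast+
  show "r \<odot>\<^bsub>M\<^esub> x \<in> \<Union>\<C>" if "r \<in> carrier R" "x \<in> \<Union>\<C>" for r x
    using that submodule_smult[OF assms(2)] by blast
qed

lemma End_closed:
  assumes "f \<in> module_End R M" "x \<in> carrier M"
  shows "f x \<in> carrier M"
  using assms by (auto simp: module_End_def hom_def)

lemma End_add:
  assumes "f \<in> module_End R M" "x \<in> carrier M" "y \<in> carrier M"
  shows "f (x \<oplus>\<^bsub>M\<^esub> y) = f x \<oplus>\<^bsub>M\<^esub> f y"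
  using assms by (auto simp: module_End_def hom_def)

lemma End_smult:
  assumes "f \<in> module_End R M" "r \<in> carrier R" "x \<in> carrier M"
  shows "f (r \<odot>\<^bsub>M\<^esub> x) = r \<odot>\<^bsub>M\<^esub> f x"
  using assms by (auto simp: module_End_def)

lemma End_zero:
  assumes "f \<in> module_End R M"
  shows "f \<zero>\<^bsub>M\<^esub> = \<zero>\<^bsub>M\<^esub>"
  using End_smult[OF assms, of "\<zero>\<^bsub>R\<^esub>" "\<zero>\<^bsub>M\<^esub>"] End_closed[OF assms, of "\<zero>\<^bsub>M\<^esub>"] by simp

lemma End_minus:
  assumes "f \<in> module_End R M" "x \<in> carrier M" "y \<in> carrier M"
  shows "f (x \<ominus>\<^bsub>M\<^esub> y) = f x \<ominus>\<^bsub>M\<^esub> f y"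
  using End_smult[OF assms(1), of "\<ominus>\<^bsub>R\<^esub> \<one>\<^bsub>R\<^esub>" y] assms
  by (simp add: a_minus_def End_add minus_one_smult End_closed)

lemma EndI:
  assumes "\<And>x. x \<in> carrier M \<Longrightarrow> f x \<in> carrier M"
    and "\<And>x y. \<lbrakk>x \<in> carrier M; y \<in> carrier M\<rbrakk> \<Longrightarrow> f (x \<oplus>\<^bsub>M\<^esub> y) = f x \<oplus>\<^bsub>M\<^esub> f y"
    and "\<And>r x. \<lbrakk>r \<in> carrier R; x \<in> carrier M\<rbrakk> \<Longrightarrow> f (r \<odot>\<^bsub>M\<^esub> x) = r \<odot>\<^bsub>M\<^esub> f x"
  shows "f \<in> module_End R M"
  using assms by (auto simp: module_End_def hom_def)

lemma End_comp:
  assumes "f \<in> module_End R M" "g \<in> module_End R M"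
  shows "(\<lambda>x. f (g x)) \<in> module_End R M"
  by (rule EndI) (use assms in \<open>simp_all add: End_closed End_add End_smult\<close>)

lemma End_funpow:
  assumes "f \<in> module_End R M"
  shows "(f ^^ n) \<in> module_End R M"
proof (induction n)
  case 0
  show ?case by (rule EndI) auto
next
  case (Suc n)
  then show ?case using End_comp[OF assms Suc] by (simp add: comp_def)
qed

lemma End_diff:
  assumes "f \<in> module_End R M" "g \<in> module_End R M"
  shows "(\<lambda>x. f x \<ominus>\<^bsub>M\<^esub> g x) \<in> module_End R M"
proof (rule EndI)
  fix x y assume xy: "x \<in> carrier M" "y \<in> carrier M"
  show "f (x \<oplus>\<^bsub>M\<^esub> y) \<ominus>\<^bsub>M\<^esub> g (x \<oplus>\<^bsub>M\<^esub> y) = f x \<ominus>\<^bsub>M\<^esub> g x \<oplus>\<^bsub>M\<^esub> (f y \<ominus>\<^bsub>M\<^esub> g y)"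
    using assms xy by (simp add: a_minus_def End_closed End_add M.minus_add M.a_ac)
next
  fix r x assume rx: "r \<in> carrier R" "x \<in> carrier M"
  then have cl: "f x \<in> carrier M" "g x \<in> carrier M"
    using assms by (auto intro: End_closed)
  have "r \<odot>\<^bsub>M\<^esub> (f x \<ominus>\<^bsub>M\<^esub> g x) \<oplus>\<^bsub>M\<^esub> r \<odot>\<^bsub>M\<^esub> g x = r \<odot>\<^bsub>M\<^esub> f x"
    using rx cl by (simp add: smult_r_distr[symmetric] a_minus_def M.a_assoc M.l_neg)
  then show "f (r \<odot>\<^bsub>M\<^esub> x) \<ominus>\<^bsub>M\<^esub> g (r \<odot>\<^bsub>M\<^esub> x) = r \<odot>\<^bsub>M\<^esub> (f x \<ominus>\<^bsub>M\<^esub> g x)"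
    using rx cl assms
    by (metis End_smult M.add.inv_solve_right M.minus_closed a_minus_def smult_closed)
qed (use assms in \<open>simp add: End_closed\<close>)

lemma submodule_image:
  assumes "f \<in> module_End R M" "submodule N R M"
  shows "submodule (f ` N) R M"
proof (rule submoduleI)
  note sub = submodule_subset[OF assms(2)]
  show "\<zero>\<^bsub>M\<^esub> \<in> f ` N"
    using End_zero[OF assms(1)] submodule_zero[OF assms(2)] by force
  show "x \<oplus>\<^bsub>M\<^esub> y \<in> f ` N" if "x \<in> f ` N" "y \<in> f ` N" for x y
    using that sub End_add[OF assms(1), symmetric] submodule_add[OF assms(2)] by auto
  show "r \<odot>\<^bsub>M\<^esub> x \<in> f ` N" if "r \<in> carrier R" "x \<in> f ` N" for r x
    using that sub End_smult[OF assms(1), symmetric] submodule_smult[OF assms(2)] by auto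
  show "f ` N \<subseteq> carrier M"
    using sub End_closed[OF assms(1)] by auto
qed

lemma submodule_preimage:
  assumes "f \<in> module_End R M" "submodule N R M"
  shows "submodule {x \<in> carrier M. f x \<in> N} R M"
  by (rule submoduleI)
    (use assms in \<open>auto simp: End_add End_smult End_zero smult_closed submodule_zero
      submodule_add submodule_smult\<close>)

lemma submodule_kernel:
  assumes "f \<in> module_End R M"
  shows "submodule {x \<in> carrier M. f x = \<zero>\<^bsub>M\<^esub>} R M"
  using submodule_preimage[OF assms submodule_zero_set] by simp

lemma span_minimal:
  assumes "A \<subseteq> N" "submodule N R M"
  shows "submodule_span R M A \<subseteq> N"
  unfolding submodule_span_def by (rule hull_minimal) (use assms in auto)

lemma zero_centralizer_iff:
  assumes "f \<in> module_End R M"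
  shows "g \<in> zero_centralizer R M f \<longleftrightarrow>
    g \<in> module_End R M \<and> (\<forall>x\<in>carrier M. g (f x) = \<zero>\<^bsub>M\<^esub> \<and> f (g x) = \<zero>\<^bsub>M\<^esub>)"
  using assms unfolding zero_centralizer_def compose_def restrict_def fun_eq_iff by auto

text \<open>
  The map sends \<open>f a + c\<close> to \<open>a\<close>. With \<open>f\<close> the identity it is the projection onto \<open>A\<close> along \<open>C\<close>; with
  \<open>A\<close> a complement of the kernel and \<open>C\<close> a complement of the image of \<open>f\<close> it is a generalized inverse
  of \<open>f\<close>. The hypothesis \<open>inj\<close> says at once that \<open>f\<close> is injective on \<open>A\<close> and that \<open>f ` A\<close> meets \<open>C\<close>
  trivially.
\<close>

lemma partial_inverse_exists:
  assumes f: "f \<in> module_End R M" and A: "submodule A R M" and C: "submodule C R M"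
    and inj: "\<And>a. \<lbrakk>a \<in> A; f a \<in> C\<rbrakk> \<Longrightarrow> a = \<zero>\<^bsub>M\<^esub>"
    and total: "\<And>x. x \<in> carrier M \<Longrightarrow> \<exists>a\<in>A. \<exists>c\<in>C. x = f a \<oplus>\<^bsub>M\<^esub> c"
  obtains g where "g \<in> module_End R M" "\<And>x. x \<in> carrier M \<Longrightarrow> g x \<in> A"
    "\<And>a. a \<in> A \<Longrightarrow> g (f a) = a" "\<And>c. c \<in> C \<Longrightarrow> g c = \<zero>\<^bsub>M\<^esub>"
proof -
  define P where "P x a \<longleftrightarrow> a \<in> A \<and> (\<exists>c\<in>C. x = f a \<oplus>\<^bsub>M\<^esub> c)" for x a
  define g where "g x = (THE a. P x a)" for x
  note subA = submodule_subset[OF A] and subC = submodule_subset[OF C]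
  note fcl = End_closed[OF f subA]
  have uniq: "a = b" if "P x a" "P x b" for x a b
  proof -
    from that obtain c d where c: "a \<in> A" "b \<in> A" "c \<in> C" "d \<in> C"
      and eq: "f a \<oplus>\<^bsub>M\<^esub> c = f b \<oplus>\<^bsub>M\<^esub> d"
      unfolding P_def by metis
    have "f (a \<ominus>\<^bsub>M\<^esub> b) = f a \<ominus>\<^bsub>M\<^esub> f b"
      using c by (simp add: End_minus[OF f] subA)
    also have "\<dots> = d \<ominus>\<^bsub>M\<^esub> c"
    proof -
      have "f a = f b \<oplus>\<^bsub>M\<^esub> (d \<ominus>\<^bsub>M\<^esub> c)"
        using eq c fcl subC
        by (metis M.add.inv_solve_right M.a_assoc M.a_closed M.add.inv_closed a_minus_def)
      then show ?thesis
        using c fcl subC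
        by (simp add: a_minus_def M.a_ac)
          (metis M.a_closed M.add.inv_closed M.r_neg M.r_zero M.a_lcomm M.a_comm)
    qed
    finally have "a \<ominus>\<^bsub>M\<^esub> b = \<zero>\<^bsub>M\<^esub>"
      using inj[of "a \<ominus>\<^bsub>M\<^esub> b"] submodule_minus[OF A] submodule_minus[OF C] c by simp
    then show "a = b"
      using c subA by (simp add: minus_eq_zero_iff)
  qed
  have g_eq: "g x = a" if "P x a" for x a
    unfolding g_def by (rule the_equality) (use that uniq in auto)
  have gP: "P x (g x)" if "x \<in> carrier M" for x
    using total[OF that] g_eq unfolding P_def by metis
  have "g \<in> module_End R M"
  proof (rule EndI)
    fix x assume "x \<in> carrier M"
    then show "g x \<in> carrier M" using gP subA unfolding P_def by blast
  next
    fix x y assume xy: "x \<in> carrier M" "y \<in> carrier M"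
    obtain c d where c: "c \<in> C" "d \<in> C" "x = f (g x) \<oplus>\<^bsub>M\<^esub> c" "y = f (g y) \<oplus>\<^bsub>M\<^esub> d"
      using gP xy unfolding P_def by blast
    have gA: "g x \<in> A" "g y \<in> A" using gP xy unfolding P_def by auto
    have "x \<oplus>\<^bsub>M\<^esub> y = (f (g x) \<oplus>\<^bsub>M\<^esub> c) \<oplus>\<^bsub>M\<^esub> (f (g y) \<oplus>\<^bsub>M\<^esub> d)"
      using c by simp
    also have "\<dots> = f (g x \<oplus>\<^bsub>M\<^esub> g y) \<oplus>\<^bsub>M\<^esub> (c \<oplus>\<^bsub>M\<^esub> d)"
      using c(1,2) gA by (simp add: End_add[OF f] subA subC fcl M.a_ac)
    finally have "P (x \<oplus>\<^bsub>M\<^esub> y) (g x \<oplus>\<^bsub>M\<^esub> g y)"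
      unfolding P_def using gA c(1,2) submodule_add[OF A] submodule_add[OF C] by blast
    then show "g (x \<oplus>\<^bsub>M\<^esub> y) = g x \<oplus>\<^bsub>M\<^esub> g y" by (rule g_eq)
  next
    fix r x assume rx: "r \<in> carrier R" "x \<in> carrier M"
    obtain c where c: "c \<in> C" "x = f (g x) \<oplus>\<^bsub>M\<^esub> c"
      using gP rx unfolding P_def by blast
    have gA: "g x \<in> A" using gP rx unfolding P_def by auto
    have "r \<odot>\<^bsub>M\<^esub> x = r \<odot>\<^bsub>M\<^esub> (f (g x) \<oplus>\<^bsub>M\<^esub> c)"
      using c by simp
    also have "\<dots> = f (r \<odot>\<^bsub>M\<^esub> g x) \<oplus>\<^bsub>M\<^esub> r \<odot>\<^bsub>M\<^esub> c"
      using c(1) gA rx by (simp add: End_smult[OF f] subA subC fcl smult_r_distr)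
    finally have "P (r \<odot>\<^bsub>M\<^esub> x) (r \<odot>\<^bsub>M\<^esub> g x)"
      unfolding P_def using rx gA c(1) submodule_smult[OF A] submodule_smult[OF C] by blast
    then show "g (r \<odot>\<^bsub>M\<^esub> x) = r \<odot>\<^bsub>M\<^esub> g x" by (rule g_eq)
  qed
  moreover have "g x \<in> A" if "x \<in> carrier M" for x
    using gP[OF that] unfolding P_def by blast
  moreover have "g (f a) = a" if "a \<in> A" for a
    by (rule g_eq) (use that submodule_zero[OF C] fcl in \<open>force simp: P_def\<close>)
  moreover have "g c = \<zero>\<^bsub>M\<^esub>" if "c \<in> C" for c
    by (rule g_eq) (use that submodule_zero[OF A] subC in \<open>force simp: P_def End_zero[OF f]\<close>)
  ultimately show ?thesis using that by blast
qed

end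

section \<open>Complements and generalized inverses in semisimple modules\<close>

locale semisimple_left_module = left_module +
  assumes semisimple: "semisimple_module R M"
begin

text \<open>
  By Zorn's lemma there is a submodule \<open>C\<close> that contains \<open>B\<close>, meets \<open>A\<close> trivially and is maximal with
  these properties. A simple summand that is not inside \<open>A + C\<close> would meet it trivially and could
  be added to \<open>C\<close>. So \<open>A + C\<close> contains all simple summands, which span \<open>M\<close>. The freedom to
  prescribe \<open>B\<close> is what allows a projection onto \<open>A\<close> to kill a given submodule.
\<close>

lemma complement_exists:
  assumes A: "submodule A R M" and B: "submodule B R M" and AB: "A \<inter> B = {\<zero>\<^bsub>M\<^esub>}"
  obtains C where "submodule C R M" "B \<subseteq> C" "A \<inter> C = {\<zero>\<^bsub>M\<^esub>}" "A <+>\<^bsub>M\<^esub> C = carrier M"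
proof -
  define \<A> where "\<A> = {C. submodule C R M \<and> B \<subseteq> C \<and> A \<inter> C = {\<zero>\<^bsub>M\<^esub>}}"
  have "\<exists>C\<in>\<A>. \<forall>Z\<in>\<A>. C \<subseteq> Z \<longrightarrow> Z = C"
  proof (rule subset_Zorn_nonempty)
    show "\<A> \<noteq> {}" using B AB by (auto simp: \<A>_def)
    fix \<C> assume ne: "\<C> \<noteq> {}" and "subset.chain \<A> \<C>"
    then have sub: "\<C> \<subseteq> \<A>" and ch: "\<And>N K. \<lbrakk>N \<in> \<C>; K \<in> \<C>\<rbrakk> \<Longrightarrow> N \<subseteq> K \<or> K \<subseteq> N"
      by (auto simp: subset_chain_def)
    have "submodule (\<Union>\<C>) R M"
      by (rule submodule_Union_chain) (use ne sub ch in \<open>auto simp: \<A>_def\<close>)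
    then show "\<Union>\<C> \<in> \<A>"
      using ne sub unfolding \<A>_def by blast
  qed
  then obtain C where "C \<in> \<A>" and max: "\<And>Z. \<lbrakk>Z \<in> \<A>; C \<subseteq> Z\<rbrakk> \<Longrightarrow> Z = C"
    by auto
  then have C: "submodule C R M" "B \<subseteq> C" "A \<inter> C = {\<zero>\<^bsub>M\<^esub>}"
    by (simp_all add: \<A>_def)
  note AC = submodule_set_add[OF A C(1)]
  obtain \<F> where \<F>: "\<And>N. N \<in> \<F> \<Longrightarrow> simple_submodule N R M"
    "submodule_span R M (\<Union>\<F>) = carrier M"
    using semisimple unfolding semisimple_module_def by metis
  have "N \<subseteq> A <+>\<^bsub>M\<^esub> C" if "N \<in> \<F>" for N
  proof -
    have N: "submodule N R M" using \<F>(1)[OF that] by (simp add: simple_submodule_def)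
    have "N \<inter> (A <+>\<^bsub>M\<^esub> C) = {\<zero>\<^bsub>M\<^esub>} \<or> N \<inter> (A <+>\<^bsub>M\<^esub> C) = N"
      using \<F>(1)[OF that] submodule_Int[OF N AC] unfolding simple_submodule_def by blast
    then show ?thesis
    proof
      assume zero: "N \<inter> (A <+>\<^bsub>M\<^esub> C) = {\<zero>\<^bsub>M\<^esub>}"
      have "A \<inter> (C <+>\<^bsub>M\<^esub> N) \<subseteq> {\<zero>\<^bsub>M\<^esub>}"
      proof
        fix a assume "a \<in> A \<inter> (C <+>\<^bsub>M\<^esub> N)"
        then obtain c n where a: "a \<in> A" "c \<in> C" "n \<in> N" "a = c \<oplus>\<^bsub>M\<^esub> n"
          by (auto simp: set_add_def')
        note cl = submodule_subset[OF A a(1)] submodule_subset[OF C(1) a(2)]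
          submodule_subset[OF N a(3)]
        have "n = a \<ominus>\<^bsub>M\<^esub> c"
          using a(4) cl by (metis M.a_closed M.a_comm M.add.inv_solve_right a_minus_def)
        moreover have "a \<ominus>\<^bsub>M\<^esub> c \<in> A <+>\<^bsub>M\<^esub> C"
          using submodule_minus[OF AC] set_add_upper[OF A C(1)] a by blast
        ultimately have "n = \<zero>\<^bsub>M\<^esub>" using zero a by blast
        then have "a = c" using a cl by simp
        then show "a \<in> {\<zero>\<^bsub>M\<^esub>}" using a C(3) by blast
      qed
      then have "C <+>\<^bsub>M\<^esub> N = C"
        using submodule_set_add[OF C(1) N] set_add_upper[OF C(1) N] C(2)
          submodule_zero[OF A] submodule_zero[OF submodule_set_add[OF C(1) N]]
        by (intro max) (auto simp: \<A>_def)
      then show ?thesis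
        using set_add_upper[OF C(1) N] set_add_upper[OF A C(1)] by blast
    qed blast
  qed
  then have "carrier M \<subseteq> A <+>\<^bsub>M\<^esub> C"
    using span_minimal[OF _ AC, of "\<Union>\<F>"] \<F>(2) by blast
  then have "A <+>\<^bsub>M\<^esub> C = carrier M"
    using submodule_subset[OF AC] by blast
  then show ?thesis using that C by blast
qed

lemma direct_complement_exists:
  assumes "submodule A R M"
  obtains C where "submodule C R M" "A \<inter> C = {\<zero>\<^bsub>M\<^esub>}" "A <+>\<^bsub>M\<^esub> C = carrier M"
proof -
  have "A \<inter> {\<zero>\<^bsub>M\<^esub>} = {\<zero>\<^bsub>M\<^esub>}"
    using submodule_zero[OF assms] by simp
  then show ?thesis
    using complement_exists[OF assms submodule_zero_set] that by metis
qed

lemma projection_exists: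
  assumes A: "submodule A R M" and B: "submodule B R M" and AB: "A \<inter> B = {\<zero>\<^bsub>M\<^esub>}"
  obtains p where "p \<in> module_End R M" "\<And>x. x \<in> carrier M \<Longrightarrow> p x \<in> A"
    "\<And>a. a \<in> A \<Longrightarrow> p a = a" "\<And>b. b \<in> B \<Longrightarrow> p b = \<zero>\<^bsub>M\<^esub>"
proof -
  obtain C where C: "submodule C R M" "B \<subseteq> C" "A \<inter> C = {\<zero>\<^bsub>M\<^esub>}" "A <+>\<^bsub>M\<^esub> C = carrier M"
    using complement_exists[OF assms] .
  have id: "(\<lambda>x. x) \<in> module_End R M" by (rule EndI) auto
  obtain p where "p \<in> module_End R M" "\<And>x. x \<in> carrier M \<Longrightarrow> p x \<in> A"
    "\<And>a. a \<in> A \<Longrightarrow> p a = a" "\<And>c. c \<in> C \<Longrightarrow> p c = \<zero>\<^bsub>M\<^esub>"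
  proof (rule partial_inverse_exists[OF id A C(1)])
    show "\<exists>a\<in>A. \<exists>c\<in>C. x = a \<oplus>\<^bsub>M\<^esub> c" if "x \<in> carrier M" for x
      using that C(4) by (metis set_addE)
  qed (use C(3) in blast)+
  then show ?thesis using that C(2) by blast
qed

text \<open>The endomorphism ring of a semisimple module is von Neumann regular.\<close>

lemma generalized_inverse_exists:
  assumes f: "f \<in> module_End R M"
  obtains g where "g \<in> module_End R M"
    "\<And>x. x \<in> carrier M \<Longrightarrow> f (g (f x)) = f x" "\<And>x. x \<in> carrier M \<Longrightarrow> g (f (g x)) = g x"
proof -
  let ?K = "{x \<in> carrier M. f x = \<zero>\<^bsub>M\<^esub>}" and ?I = "f ` carrier M"
  have K: "submodule ?K R M" by (rule submodule_kernel[OF f])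
  have I: "submodule ?I R M" by (rule submodule_image[OF f submodule_carrier])
  obtain A where A: "submodule A R M" "?K \<inter> A = {\<zero>\<^bsub>M\<^esub>}" "?K <+>\<^bsub>M\<^esub> A = carrier M"
    using direct_complement_exists[OF K] by blast
  obtain C where C: "submodule C R M" "?I \<inter> C = {\<zero>\<^bsub>M\<^esub>}" "?I <+>\<^bsub>M\<^esub> C = carrier M"
    using direct_complement_exists[OF I] by blast
  note subA = submodule_subset[OF A(1)]
  have fA: "\<exists>a\<in>A. f x = f a" if "x \<in> carrier M" for x
  proof -
    from that A(3) have "x \<in> ?K <+>\<^bsub>M\<^esub> A" by simp
    then obtain k a where "k \<in> ?K" "a \<in> A" "x = k \<oplus>\<^bsub>M\<^esub> a"
      by (rule set_addE)
    then show ?thesis using subA by (auto simp: End_add[OF f] End_closed[OF f])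
  qed
  have dec: "\<exists>a\<in>A. \<exists>c\<in>C. x = f a \<oplus>\<^bsub>M\<^esub> c" if "x \<in> carrier M" for x
  proof -
    from that C(3) have "x \<in> ?I <+>\<^bsub>M\<^esub> C" by simp
    then obtain z c where "z \<in> carrier M" "c \<in> C" "x = f z \<oplus>\<^bsub>M\<^esub> c"
      by (auto elim!: set_addE)
    then show ?thesis using fA[of z] by metis
  qed
  have inj: "a = \<zero>\<^bsub>M\<^esub>" if "a \<in> A" "f a \<in> C" for a
    using that A(2) C(2) subA by blast
  obtain g where g: "g \<in> module_End R M" "\<And>x. x \<in> carrier M \<Longrightarrow> g x \<in> A"
    "\<And>a. a \<in> A \<Longrightarrow> g (f a) = a"
    using partial_inverse_exists[OF f A(1) C(1) inj dec] by metis
  have "f (g (f x)) = f x" if "x \<in> carrier M" for x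
    using fA[OF that] g(3) by force
  then show ?thesis using that g by blast
qed

end

section \<open>Chain condition for finitely generated semisimple modules\<close>

locale fg_semisimple_left_module = semisimple_left_module +
  assumes finitely_generated: "finitely_generated_module R M"
begin

text \<open>
  The union \<open>U\<close> of the chain is the image of a projection \<open>p\<close>. The finitely many generators of \<open>M\<close>
  are all mapped by \<open>p\<close> into one member of the chain, which therefore contains \<open>p M = U\<close>.
\<close>

lemma ascending_chain_stationary:
  fixes N :: "nat \<Rightarrow> _"
  assumes N: "\<And>n. submodule (N n) R M" and mono: "mono N"
  obtains n where "\<And>m. N m \<subseteq> N n"
proof -
  define U where "U = \<Union>(range N)"
  have U: "submodule U R M"
    unfolding U_def
  proof (rule submodule_Union_chain)
    fix K L assume "K \<in> range N" "L \<in> range N"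
    then obtain i j where "K = N i" "L = N j" by blast
    then show "K \<subseteq> L \<or> L \<subseteq> K"
      using monoD[OF mono, of i j] monoD[OF mono, of j i] linear[of i j] by blast
  qed (use N in auto)
  have U0: "U \<inter> {\<zero>\<^bsub>M\<^esub>} = {\<zero>\<^bsub>M\<^esub>}"
    using submodule_zero[OF U] by simp
  obtain p where p: "p \<in> module_End R M" "\<And>x. x \<in> carrier M \<Longrightarrow> p x \<in> U"
    "\<And>a. a \<in> U \<Longrightarrow> p a = a" "\<And>b. b \<in> {\<zero>\<^bsub>M\<^esub>} \<Longrightarrow> p b = \<zero>\<^bsub>M\<^esub>"
    by (rule projection_exists[OF U submodule_zero_set U0]) blast
  obtain G where G: "finite G" "G \<subseteq> carrier M" "submodule_span R M G = carrier M"
    using finitely_generated unfolding finitely_generated_module_def by blast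
  have "\<exists>n. \<forall>x\<in>G. p x \<in> N n"
    using G(1,2)
  proof (induction G)
    case (insert y F)
    then obtain n m where "\<forall>x\<in>F. p x \<in> N n" "p y \<in> N m"
      using p(2)[of y] by (auto simp: U_def)
    then have "\<forall>x\<in>insert y F. p x \<in> N (max n m)"
      using monoD[OF mono, of n "max n m"] monoD[OF mono, of m "max n m"] by auto
    then show ?case by blast
  qed auto
  then obtain n where "G \<subseteq> {x \<in> carrier M. p x \<in> N n}"
    using G(2) by blast
  then have "carrier M \<subseteq> {x \<in> carrier M. p x \<in> N n}"
    using span_minimal submodule_preimage[OF p(1) N] G(3) by metis
  then have "N m \<subseteq> N n" for m
    using p(3) submodule_subset[OF N] unfolding U_def by fastforce
  then show ?thesis using that by blast
qed

lemma kernel_funpow_stationary: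
  assumes f: "f \<in> module_End R M"
  obtains n where "\<And>x. \<lbrakk>x \<in> carrier M; (f ^^ Suc n) x = \<zero>\<^bsub>M\<^esub>\<rbrakk> \<Longrightarrow> (f ^^ n) x = \<zero>\<^bsub>M\<^esub>"
proof -
  define N where "N n = {x \<in> carrier M. (f ^^ n) x = \<zero>\<^bsub>M\<^esub>}" for n
  have "mono N"
    by (rule mono_iff_le_Suc[THEN iffD2]) (auto simp: N_def End_zero[OF f])
  moreover have "submodule (N n) R M" for n
    unfolding N_def by (rule submodule_kernel[OF End_funpow[OF f]])
  ultimately obtain n where "\<And>m. N m \<subseteq> N n"
    using ascending_chain_stationary by blast
  then have "N (Suc n) \<subseteq> N n" .
  then show ?thesis using that unfolding N_def by blast
qed

section \<open>The images of the zero-level centralizer fill the kernel\<close>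

text \<open>
  The induction runs downwards on \<open>i\<close>, over the statement that \<open>s\<close> vanishes on \<open>ker f \<inter> im f\<^sup>i\<close>. This
  intersection is the image under \<open>f\<^sup>i\<close> of \<open>ker f\<^sup>i\<^sup>+\<^sup>1\<close>, which is how \<open>P i\<close> expresses it.
\<close>

lemma kernel_subset_if_annihilates:
  assumes f: "f \<in> module_End R M" and s: "s \<in> module_End R M"
    and ann: "\<And>g x. \<lbrakk>g \<in> zero_centralizer R M f; x \<in> carrier M\<rbrakk> \<Longrightarrow> s (g x) = \<zero>\<^bsub>M\<^esub>"
    and x: "x \<in> carrier M" "f x = \<zero>\<^bsub>M\<^esub>"
  shows "s x = \<zero>\<^bsub>M\<^esub>"
proof -
  define P where "P i \<longleftrightarrow> (\<forall>y\<in>carrier M. (f ^^ Suc i) y = \<zero>\<^bsub>M\<^esub> \<longrightarrow> s ((f ^^ i) y) = \<zero>\<^bsub>M\<^esub>)" for i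
  note fcl = End_closed[OF f] and fn = End_funpow[OF f]
  note fncl = End_closed[OF fn]
  obtain n where n: "\<And>x. \<lbrakk>x \<in> carrier M; (f ^^ Suc n) x = \<zero>\<^bsub>M\<^esub>\<rbrakk> \<Longrightarrow> (f ^^ n) x = \<zero>\<^bsub>M\<^esub>"
    using kernel_funpow_stationary[OF f] by blast
  have "P n"
    unfolding P_def
  proof (intro ballI impI)
    fix y assume "y \<in> carrier M" "(f ^^ Suc n) y = \<zero>\<^bsub>M\<^esub>"
    then show "s ((f ^^ n) y) = \<zero>\<^bsub>M\<^esub>"
      using n[of y] End_zero[OF s] by simp
  qed
  have step: "P i" if "P (Suc i)" for i
    unfolding P_def
  proof (intro ballI impI)
    let ?B = "{y \<in> carrier M. (f ^^ Suc i) y = \<zero>\<^bsub>M\<^esub>}"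
    \<comment> \<open>Within \<open>?B\<close>, the elements of \<open>?D\<close> are those that \<open>f\<^sup>i\<close> maps into \<open>im f\<^sup>i\<^sup>+\<^sup>1\<close>, that is, those
      covered by the induction hypothesis.\<close>
    let ?D = "{y \<in> carrier M. (f ^^ i) y = \<zero>\<^bsub>M\<^esub>} <+>\<^bsub>M\<^esub> f ` carrier M"
    fix y assume y: "y \<in> carrier M" "(f ^^ Suc i) y = \<zero>\<^bsub>M\<^esub>"
    have B: "submodule ?B R M" by (rule submodule_kernel[OF fn])
    have K: "submodule {y \<in> carrier M. (f ^^ i) y = \<zero>\<^bsub>M\<^esub>} R M" by (rule submodule_kernel[OF fn])
    have I: "submodule (f ` carrier M) R M" by (rule submodule_image[OF f submodule_carrier])
    have D: "submodule ?D R M" by (rule submodule_set_add[OF K I])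
    have BD: "submodule (?B \<inter> ?D) R M" by (rule submodule_Int[OF B D])
    obtain Z where Z: "submodule Z R M" "(?B \<inter> ?D) \<inter> Z = {\<zero>\<^bsub>M\<^esub>}"
      "(?B \<inter> ?D) <+>\<^bsub>M\<^esub> Z = carrier M"
      using direct_complement_exists[OF BD] by blast
    \<comment> \<open>\<open>T\<close> is a complement of \<open>?B \<inter> ?D\<close> in \<open>?B\<close>; it meets \<open>im f\<close> trivially because \<open>im f \<subseteq> ?D\<close>.\<close>
    define T where "T = Z \<inter> ?B"
    have T: "submodule T R M" unfolding T_def by (rule submodule_Int[OF Z(1) B])
    have "T \<inter> f ` carrier M = {\<zero>\<^bsub>M\<^esub>}"
      using Z(2) set_add_upper(2)[OF K I] submodule_zero[OF T] submodule_zero[OF I]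
      by (auto simp: T_def)
    then obtain p where p: "p \<in> module_End R M" "\<And>x. x \<in> carrier M \<Longrightarrow> p x \<in> T"
      "\<And>a. a \<in> T \<Longrightarrow> p a = a" "\<And>b. b \<in> f ` carrier M \<Longrightarrow> p b = \<zero>\<^bsub>M\<^esub>"
      using projection_exists[OF T I] by metis
    have g: "(\<lambda>x. (f ^^ i) (p x)) \<in> zero_centralizer R M f"
      unfolding zero_centralizer_iff[OF f]
      using End_comp[OF fn p(1)] p(2,4) End_zero[OF fn] by (auto simp: T_def)
    from y(1) Z(3) have "y \<in> (?B \<inter> ?D) <+>\<^bsub>M\<^esub> Z" by simp
    then obtain d t where d: "d \<in> ?B" "d \<in> ?D" "t \<in> Z" "y = d \<oplus>\<^bsub>M\<^esub> t"
      by (rule set_addE) blast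
    have dt: "d \<in> carrier M" "t \<in> carrier M" using d submodule_subset[OF Z(1)] by auto
    have "(f ^^ Suc i) d \<oplus>\<^bsub>M\<^esub> (f ^^ Suc i) t = \<zero>\<^bsub>M\<^esub>"
      using y(2) d(4) End_add[OF fn dt] by metis
    then have "t \<in> T"
      unfolding T_def using d dt fncl[OF dt(2), of "Suc i"] by auto
    then have st: "s ((f ^^ i) t) = \<zero>\<^bsub>M\<^esub>"
      using ann[OF g, of t] p(3) dt by simp
    obtain k z where k: "k \<in> carrier M" "(f ^^ i) k = \<zero>\<^bsub>M\<^esub>" "z \<in> carrier M" "d = k \<oplus>\<^bsub>M\<^esub> f z"
      using d(2) by (auto elim!: set_addE)
    have fd: "(f ^^ i) d = (f ^^ Suc i) z"
      using k fcl fncl End_add[OF fn, of k "f z" i] by (simp add: funpow_swap1)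
    then have "(f ^^ Suc (Suc i)) z = \<zero>\<^bsub>M\<^esub>"
      using d(1) by simp
    then have "s ((f ^^ i) d) = \<zero>\<^bsub>M\<^esub>"
      using \<open>P (Suc i)\<close> k(3) fd unfolding P_def by metis
    then show "s ((f ^^ i) y) = \<zero>\<^bsub>M\<^esub>"
      using st d(4) dt fncl by (simp add: End_add[OF fn] End_add[OF s])
  qed
  have "P 0"
    using \<open>P n\<close> by (rule inc_induct[of 0 n P, rotated]) (use step in auto)
  then show ?thesis using x by (simp add: P_def)
qed

section \<open>The common kernel of the zero-level centralizer is the image\<close>

text \<open>
  Let \<open>N\<close> be the part of \<open>ker h\<close> that all of \<open>Cen\<^sub>0(f)\<close> kills. Since \<open>ker h\<close> is a complement of \<open>im f\<close> and
  \<open>y - f (h y)\<close> belongs to \<open>N\<close>, it suffices that \<open>N = 0\<close>. A projection \<open>p\<close> onto \<open>N\<close> that kills \<open>im f\<close>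
  must annihilate the images of all \<open>q \<in> Cen\<^sub>0(h)\<close>: a generalized inverse \<open>r\<close> of \<open>p q\<close>, followed by the
  projection \<open>e = 1 - h f\<close> onto \<open>ker f\<close>, gives \<open>e r p \<in> Cen\<^sub>0(f)\<close>, which kills \<open>N\<close>, and so
  \<open>p q = p q r p q = p q e r p q = 0\<close>. The result on kernels, applied to \<open>h\<close>, then says that \<open>p\<close>
  vanishes on \<open>ker h\<close>, which contains \<open>N\<close>.
\<close>

lemma image_subset_if_annihilated:
  assumes f: "f \<in> module_End R M"
    and y: "y \<in> carrier M"
    and ann: "\<And>g. g \<in> zero_centralizer R M f \<Longrightarrow> g y = \<zero>\<^bsub>M\<^esub>"
  shows "y \<in> f ` carrier M"
proof -
  note fcl = End_closed[OF f]
  obtain h where h: "h \<in> module_End R M"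
    and fhf: "\<And>x. x \<in> carrier M \<Longrightarrow> f (h (f x)) = f x"
    and hfh: "\<And>x. x \<in> carrier M \<Longrightarrow> h (f (h x)) = h x"
    using generalized_inverse_exists[OF f] by blast
  note hcl = End_closed[OF h]
  define N where "N = {v \<in> carrier M. h v = \<zero>\<^bsub>M\<^esub> \<and> (\<forall>g\<in>zero_centralizer R M f. g v = \<zero>\<^bsub>M\<^esub>)}"
  have N: "submodule N R M"
  proof (rule submoduleI)
    have gE: "g \<in> module_End R M" if "g \<in> zero_centralizer R M f" for g
      using that by (simp add: zero_centralizer_iff[OF f])
    show "N \<subseteq> carrier M" by (auto simp: N_def)
    have NI: "v \<in> N" if "v \<in> carrier M" "h v = \<zero>\<^bsub>M\<^esub>"
      "\<And>g. g \<in> zero_centralizer R M f \<Longrightarrow> g v = \<zero>\<^bsub>M\<^esub>" for v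
      using that unfolding N_def by blast
    have ND: "v \<in> carrier M" "h v = \<zero>\<^bsub>M\<^esub>"
      "\<And>g. g \<in> zero_centralizer R M f \<Longrightarrow> g v = \<zero>\<^bsub>M\<^esub>" if "v \<in> N" for v
      using that unfolding N_def by blast+
    show "\<zero>\<^bsub>M\<^esub> \<in> N"
      by (rule NI) (simp_all add: End_zero[OF h] End_zero[OF gE])
    show "x \<oplus>\<^bsub>M\<^esub> y \<in> N" if "x \<in> N" "y \<in> N" for x y
      by (rule NI) (simp_all add: End_add[OF h] End_add[OF gE] ND that)
    show "a \<odot>\<^bsub>M\<^esub> x \<in> N" if "a \<in> carrier R" "x \<in> N" for a x
      by (rule NI) (simp_all add: End_smult[OF h] End_smult[OF gE] ND that smult_closed)
  qed
  have I: "submodule (f ` carrier M) R M" by (rule submodule_image[OF f submodule_carrier])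
  have NI: "N \<inter> f ` carrier M = {\<zero>\<^bsub>M\<^esub>}"
  proof (intro equalityI subsetI)
    fix v assume "v \<in> N \<inter> f ` carrier M"
    then obtain x where "x \<in> carrier M" "v = f x" "h (f x) = \<zero>\<^bsub>M\<^esub>"
      by (auto simp: N_def)
    then show "v \<in> {\<zero>\<^bsub>M\<^esub>}" using fhf[of x] End_zero[OF f] by simp
  qed (use submodule_zero[OF N] submodule_zero[OF I] in auto)
  obtain p where p: "p \<in> module_End R M" "\<And>x. x \<in> carrier M \<Longrightarrow> p x \<in> N"
      "\<And>a. a \<in> N \<Longrightarrow> p a = a" "\<And>b. b \<in> f ` carrier M \<Longrightarrow> p b = \<zero>\<^bsub>M\<^esub>"
    using projection_exists[OF N I NI] by blast
  note pcl = End_closed[OF p(1)]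
  have "p (q x) = \<zero>\<^bsub>M\<^esub>" if q: "q \<in> zero_centralizer R M h" and x: "x \<in> carrier M" for q x
  proof -
    have qE: "q \<in> module_End R M" and qh: "\<And>x. x \<in> carrier M \<Longrightarrow> q (h x) = \<zero>\<^bsub>M\<^esub>"
      using q by (auto simp: zero_centralizer_iff[OF h])
    note qcl = End_closed[OF qE]
    obtain r where r: "r \<in> module_End R M"
      and prp: "\<And>x. x \<in> carrier M \<Longrightarrow> p (q (r (p (q x)))) = p (q x)"
      using generalized_inverse_exists[OF End_comp[OF p(1) qE]] by metis
    note rcl = End_closed[OF r]
    define e where "e x = x \<ominus>\<^bsub>M\<^esub> h (f x)" for x
    have e: "e \<in> module_End R M"
      unfolding e_def by (rule End_diff[OF _ End_comp[OF h f]]) (rule EndI, auto)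
    have fe: "f (e x) = \<zero>\<^bsub>M\<^esub>" and qe: "q (e x) = q x" if "x \<in> carrier M" for x
      using that fcl hcl qcl fhf qh
      by (simp_all add: e_def End_minus[OF f] End_minus[OF qE] minus_eq_zero_iff minus_zero)
    have erp: "(\<lambda>x. e (r (p x))) \<in> zero_centralizer R M f"
      unfolding zero_centralizer_iff[OF f]
      using End_comp[OF e End_comp[OF r p(1)]] p(4) fe pcl rcl End_zero[OF r] End_zero[OF e] by auto
    have "p (q x) \<in> N" using p(2) qcl x by simp
    then have "\<forall>g\<in>zero_centralizer R M f. g (p (q x)) = \<zero>\<^bsub>M\<^esub>"
      unfolding N_def by simp
    from bspec[OF this erp] have "e (r (p (p (q x)))) = \<zero>\<^bsub>M\<^esub>" .
    then have "q (r (p (q x))) = \<zero>\<^bsub>M\<^esub>"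
      using qe[of "r (p (q x))"] p(3)[OF p(2)] x qcl pcl rcl End_zero[OF qE] by simp
    then show ?thesis using prp[OF x] End_zero[OF p(1)] by simp
  qed
  then have p_kills: "p x = \<zero>\<^bsub>M\<^esub>" if "x \<in> carrier M" "h x = \<zero>\<^bsub>M\<^esub>" for x
    using kernel_subset_if_annihilates[OF h p(1) _ that] by blast
  define v where "v = y \<ominus>\<^bsub>M\<^esub> f (h y)"
  have v: "v \<in> carrier M" "h v = \<zero>\<^bsub>M\<^esub>"
    using y hcl fcl hfh by (simp_all add: v_def End_minus[OF h] minus_eq_zero_iff)
  have "g v = \<zero>\<^bsub>M\<^esub>" if "g \<in> zero_centralizer R M f" for g
  proof -
    have g: "g \<in> module_End R M" and gf: "g (f (h y)) = \<zero>\<^bsub>M\<^esub>"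
      using that y hcl by (auto simp: zero_centralizer_iff[OF f])
    show ?thesis
      using y hcl fcl gf by (simp add: v_def End_minus[OF g] ann[OF that] minus_zero)
  qed
  then have "v \<in> N" using v unfolding N_def by blast
  then have "v = \<zero>\<^bsub>M\<^esub>" using p(3)[of v] p_kills[OF v] by simp
  then have "y = f (h y)" using y hcl fcl by (simp add: v_def minus_eq_zero_iff)
  then show ?thesis using y hcl by blast
qed

end

section \<open>Inclusion of zero-level centralizers\<close>

theorem theorem4p4:
  fixes R :: "('a, 'm) ring_scheme" and M :: "('a, 'b, 'n) module_scheme"
    and \<phi> \<sigma> :: "'b \<Rightarrow> 'b"
  assumes "left_module R M"
    and "finitely_generated_module R M"
    and "semisimple_module R M"
    and "\<phi> \<in> module_End R M"
    and "\<sigma> \<in> module_End R M"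
  shows "zero_centralizer R M \<phi> \<subseteq> zero_centralizer R M \<sigma> \<longleftrightarrow>
    a_kernel M M \<phi> \<subseteq> a_kernel M M \<sigma> \<and> \<sigma> ` carrier M \<subseteq> \<phi> ` carrier M"
proof -
  interpret left_module R M by fact
  interpret fg_semisimple_left_module R M
    by unfold_locales (use assms in auto)
  note \<phi> = assms(4) and \<sigma> = assms(5)
  note iff = zero_centralizer_iff[OF \<phi>] zero_centralizer_iff[OF \<sigma>]
  show ?thesis
  proof
    assume sub: "zero_centralizer R M \<phi> \<subseteq> zero_centralizer R M \<sigma>"
    have "\<sigma> x = \<zero>\<^bsub>M\<^esub>" if "x \<in> carrier M" "\<phi> x = \<zero>\<^bsub>M\<^esub>" for x
      by (rule kernel_subset_if_annihilates[OF \<phi> \<sigma> _ that]) (use sub iff in blast)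
    moreover have "\<sigma> x \<in> \<phi> ` carrier M" if "x \<in> carrier M" for x
      by (rule image_subset_if_annihilated[OF \<phi>])
        (use sub iff that End_closed[OF \<sigma>] in blast)+
    ultimately show "a_kernel M M \<phi> \<subseteq> a_kernel M M \<sigma> \<and> \<sigma> ` carrier M \<subseteq> \<phi> ` carrier M"
      by (auto simp: a_kernel_def')
  next
    assume "a_kernel M M \<phi> \<subseteq> a_kernel M M \<sigma> \<and> \<sigma> ` carrier M \<subseteq> \<phi> ` carrier M"
    then have ker: "\<And>x. \<lbrakk>x \<in> carrier M; \<phi> x = \<zero>\<^bsub>M\<^esub>\<rbrakk> \<Longrightarrow> \<sigma> x = \<zero>\<^bsub>M\<^esub>"
      and im: "\<And>x. x \<in> carrier M \<Longrightarrow> \<exists>z\<in>carrier M. \<sigma> x = \<phi> z"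
      by (auto simp: a_kernel_def')
    show "zero_centralizer R M \<phi> \<subseteq> zero_centralizer R M \<sigma>"
    proof
      fix \<psi> assume "\<psi> \<in> zero_centralizer R M \<phi>"
      then have \<psi>: "\<psi> \<in> module_End R M"
        and z: "\<And>x. x \<in> carrier M \<Longrightarrow> \<psi> (\<phi> x) = \<zero>\<^bsub>M\<^esub>" "\<And>x. x \<in> carrier M \<Longrightarrow> \<phi> (\<psi> x) = \<zero>\<^bsub>M\<^esub>"
        by (auto simp: iff)
      have "\<psi> (\<sigma> x) = \<zero>\<^bsub>M\<^esub>" "\<sigma> (\<psi> x) = \<zero>\<^bsub>M\<^esub>" if "x \<in> carrier M" for x
        using im[OF that] z ker that End_closed[OF \<psi>] by auto
      then show "\<psi> \<in> zero_centralizer R M \<sigma>" using \<psi> by (simp add: iff)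
    qed
  qed
qed

end
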